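(* Let $\dot\omega=v(\omega)$, $\omega\in\mathbb{R}^p$, be the reduced Euler--Poincaré--Suslov system with $p=n-m$. If $p=2$, then either all positions are steady (i.e. $v_1=v_2\equiv 0$), or there is exactly one straight line of steady motions.
   Context: Setting (Euler--Poincaré--Suslov, EPS, systems). Let $G$ be an $n$-dimensional real Lie group with Lie algebra $g$, and let $w_1,\dots,w_n$ be a basis of left-invariant vector fields with $[w_i,w_j]=\sum_{k=1}^n c_{ij}^k w_k$, $c_{ij}^k=-c_{ji}^k$ (structure constants). Let $\omega_1,\dots,\omega_n$ be the corresponding linear coordinates on $g$ (quasi-velocities). The left-invariant kinetic energy is $T=\frac12\sum_{i,j} I_{ij}\omega_i\omega_j$, where $\|I_{ij}\|$ is a constant symmetric positive definite matrix, and $m_i=\partial T/\partial\omega_i=\sum_j I_{ij}\omega_j$. There are $m<n$ linearly independent left-invariant constraints $f_1(\omega)=\dots=f_m(\omega)=0$, linear in $\omega$ with constant coefficients. The equations of motion are $$\dot m_i=\sum_{j,k=1}^n c_{ji}^k m_k\omega_j+\sum_{q=1}^m\lambda_q\frac{\partial f_q}{\partial\omega_i},\quad 1\le i\le n,\qquad f_1(\omega)=\dots=f_m(\omega)=0,$$ with Lagrange multipliers $\lambda_q$. Put $p=n-m$ and assume $p\ge 2$. The basis is chosen so that $f_1=\omega_{p+1},\dots,f_m=\omega_n$. Setting $\omega_{p+1}=\dots=\omega_n=0$, the first $p$ equations $$\sum_{j=1}^p I_{ij}\dot\omega_j=\sum_{j=1}^p\sum_{k=1}^n c_{ji}^k\Big(\sum_{l=1}^p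 I_{kl}\omega_l\Big)\omega_j,\quad 1\le i\le p,$$ form a closed system, the reduced EPS system, written $\dot\omega=v(\omega)$, $\omega=(\omega_1,\dots,\omega_p)^\top\in\mathbb{R}^p$. The components $v_1,\dots,v_p$ are homogeneous polynomials of degree 2 (so $v(\lambda\omega)=\lambda^2v(\omega)$), and the system has the first integral $H$, the restriction of $T$ to the constraint subspace, which is a positive definite quadratic form. A steady motion is a point $\omega_0\in\mathbb{R}^p$ with $v(\omega_0)=0$. If $\omega_0\neq0$ is a steady motion, then every point of the line $\{\mu\omega_0:\mu\in\mathbb{R}\}$ is a steady motion; such a line is called a straight line of steady motions (SLSM). *)

theory Defs
  imports "HOL-Analysis.Analysis"
begin

section \<open>Smooth maps between Euclidean spaces\<close>

text \<open>The two notions below are meant for an open set \<open>S\<close>, where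
  \<^term>\<open>f differentiable_on S\<close> is ordinary differentiability at each point of \<open>S\<close>.\<close>

fun C_k_on :: "nat \<Rightarrow> ('a::euclidean_space \<Rightarrow> 'b::real_normed_vector) \<Rightarrow> 'a set \<Rightarrow> bool" where
  "C_k_on 0 f S \<longleftrightarrow> continuous_on S f"
| "C_k_on (Suc k) f S \<longleftrightarrow> f differentiable_on S \<and>
     (\<forall>b\<in>Basis. C_k_on k (\<lambda>x. frechet_derivative f (at x) b) S)"

definition smooth_on :: "('a::euclidean_space \<Rightarrow> 'b::real_normed_vector) \<Rightarrow> 'a set \<Rightarrow> bool" where
  "smooth_on f S \<longleftrightarrow> (\<forall>k. C_k_on k f S)"

section \<open>Lie groups\<close>

text \<open>A chart is a pair \<open>(U, \<phi>)\<close> of an open set and a coordinate map with values in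
  \<^typ>\<open>real ^ 'n\<close>; only the values of \<open>\<phi>\<close> on \<open>U\<close> matter. The dimension is \<^term>\<open>CARD('n)\<close>.
  Groups are multiplicative, with the locale \<^locale>\<open>group\<close> of \<^theory>\<open>HOL.Groups\<close>.
  Continuity of the operations is required separately because it makes the sets in the two
  smoothness axioms open.\<close>

type_synonym ('g, 'n) atlas = "('g set \<times> ('g \<Rightarrow> real ^ 'n)) set"

locale lie_group = group gmult gunit ginv
  for gmult :: "'g::{t2_space, second_countable_topology} \<Rightarrow> 'g \<Rightarrow> 'g"
    and gunit :: 'g
    and ginv :: "'g \<Rightarrow> 'g" +
  fixes charts :: "('g, 'n::finite) atlas"
  assumes charts_cover: "(\<Union>(U, \<phi>)\<in>charts. U) = UNIV"
    and chart_homeomorphism: "(U, \<phi>) \<in> charts \<Longrightarrow>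
      open U \<and> open (\<phi> ` U) \<and> homeomorphism U (\<phi> ` U) \<phi> (inv_into U \<phi>)"
    and charts_compatible: "(U, \<phi>) \<in> charts \<Longrightarrow> (V, \<psi>) \<in> charts \<Longrightarrow>
      smooth_on (\<lambda>x. \<psi> (inv_into U \<phi> x)) (\<phi> ` (U \<inter> V))"
    and continuous_mult: "continuous_on UNIV (\<lambda>(a, b). gmult a b)"
    and smooth_mult: "(U, \<phi>) \<in> charts \<Longrightarrow> (V, \<psi>) \<in> charts \<Longrightarrow> (W, \<theta>) \<in> charts \<Longrightarrow>
      smooth_on (\<lambda>(x, y). \<theta> (gmult (inv_into U \<phi> x) (inv_into V \<psi> y)))
        {(x, y). x \<in> \<phi> ` U \<and> y \<in> \<psi> ` V \<and> gmult (inv_into U \<phi> x) (inv_into V \<psi> y) \<in> W}"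
    and continuous_ginv: "continuous_on UNIV ginv"
    and smooth_ginv: "(U, \<phi>) \<in> charts \<Longrightarrow> (V, \<psi>) \<in> charts \<Longrightarrow>
      smooth_on (\<lambda>x. \<psi> (ginv (inv_into U \<phi> x)))
        {x. x \<in> \<phi> ` U \<and> ginv (inv_into U \<phi> x) \<in> V}"

definition smooth_fun :: "('g, 'n::finite) atlas \<Rightarrow> ('g \<Rightarrow> real) \<Rightarrow> bool" where
  "smooth_fun charts f \<longleftrightarrow>
     (\<forall>(U, \<phi>)\<in>charts. smooth_on (\<lambda>x. f (inv_into U \<phi> x)) (\<phi> ` U))"

text \<open>Vector fields are derivations of the algebra of smooth functions. The values of \<open>X\<close> on
  functions that are not smooth carry no meaning, so vector fields are always compared on
  smooth functions only.\<close>

definition vector_field :: "('g, 'n::finite) atlas \<Rightarrow> (('g \<Rightarrow> real) \<Rightarrow> 'g \<Rightarrow> real) \<Rightarrow> bool" where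
  "vector_field charts X \<longleftrightarrow>
     (\<forall>f. smooth_fun charts f \<longrightarrow> smooth_fun charts (X f)) \<and>
     (\<forall>f h a b. smooth_fun charts f \<longrightarrow> smooth_fun charts h \<longrightarrow>
        X (\<lambda>x. a * f x + b * h x) = (\<lambda>x. a * X f x + b * X h x)) \<and>
     (\<forall>f h. smooth_fun charts f \<longrightarrow> smooth_fun charts h \<longrightarrow>
        X (\<lambda>x. f x * h x) = (\<lambda>x. X f x * h x + f x * X h x))"

definition left_invariant_field ::
    "('g, 'n::finite) atlas \<Rightarrow> ('g \<Rightarrow> 'g \<Rightarrow> 'g) \<Rightarrow> (('g \<Rightarrow> real) \<Rightarrow> 'g \<Rightarrow> real) \<Rightarrow> bool" where
  "left_invariant_field charts gmult X \<longleftrightarrow> vector_field charts X \<and>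
     (\<forall>f a. smooth_fun charts f \<longrightarrow> X (\<lambda>x. f (gmult a x)) = (\<lambda>x. X f (gmult a x)))"

definition left_invariant_basis ::
    "('g, 'n::finite) atlas \<Rightarrow> ('g \<Rightarrow> 'g \<Rightarrow> 'g) \<Rightarrow> ('n \<Rightarrow> ('g \<Rightarrow> real) \<Rightarrow> 'g \<Rightarrow> real) \<Rightarrow> bool" where
  "left_invariant_basis charts gmult w \<longleftrightarrow>
     (\<forall>i. left_invariant_field charts gmult (w i)) \<and>
     (\<forall>a. (\<forall>f x. smooth_fun charts f \<longrightarrow> (\<Sum>i\<in>UNIV. a i * w i f x) = 0) \<longrightarrow> (\<forall>i. a i = 0)) \<and>
     (\<forall>X. left_invariant_field charts gmult X \<longrightarrow>
        (\<exists>a. \<forall>f x. smooth_fun charts f \<longrightarrow> X f x = (\<Sum>i\<in>UNIV. a i * w i f x)))"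

definition lie_bracket ::
    "(('g \<Rightarrow> real) \<Rightarrow> 'g \<Rightarrow> real) \<Rightarrow> (('g \<Rightarrow> real) \<Rightarrow> 'g \<Rightarrow> real) \<Rightarrow> ('g \<Rightarrow> real) \<Rightarrow> 'g \<Rightarrow> real" where
  "lie_bracket X Y f x = X (Y f) x - Y (X f) x"

text \<open>\<^term>\<open>c i j k\<close> is the coefficient of \<^term>\<open>w k\<close> in the bracket of \<^term>\<open>w i\<close> and \<^term>\<open>w j\<close>.\<close>

definition structure_constants ::
    "('g, 'n::finite) atlas \<Rightarrow> ('n \<Rightarrow> ('g \<Rightarrow> real) \<Rightarrow> 'g \<Rightarrow> real) \<Rightarrow> ('n \<Rightarrow> 'n \<Rightarrow> 'n \<Rightarrow> real) \<Rightarrow> bool" where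
  "structure_constants charts w c \<longleftrightarrow>
     (\<forall>i j f x. smooth_fun charts f \<longrightarrow>
        lie_bracket (w i) (w j) f x = (\<Sum>k\<in>UNIV. c i j k * w k f x))"

section \<open>The reduced Euler--Poincare--Suslov system\<close>

definition inertia_matrix :: "real ^ 'n ^ 'n::finite \<Rightarrow> bool" where
  "inertia_matrix J \<longleftrightarrow> transpose J = J \<and> (\<forall>x. x \<noteq> 0 \<longrightarrow> x \<bullet> (J *v x) > 0)"

text \<open>The quasi-velocities are indexed by \<^typ>\<open>'p + 'm\<close>. Those with index \<^term>\<open>Inr q\<close> are the ones
  annihilated by the \<^term>\<open>CARD('m)\<close> constraints, so that a constrained velocity is given by its
  components \<^term>\<open>\<omega> $ i\<close> at the indices \<^term>\<open>Inl i\<close>. The momenta \<open>m\<^sub>k\<close>, restricted to the constraint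
  subspace, still run over all \<open>k\<close>. The left hand matrix is a principal submatrix of a positive
  definite matrix, so the equations determine \<open>v\<close> uniquely (see the lemma below).\<close>

definition reduced_EPS_field ::
    "('p + 'm \<Rightarrow> 'p + 'm \<Rightarrow> 'p + 'm \<Rightarrow> real) \<Rightarrow> real ^ ('p::finite + 'm::finite) ^ ('p + 'm) \<Rightarrow>
     (real ^ 'p \<Rightarrow> real ^ 'p) \<Rightarrow> bool" where
  "reduced_EPS_field c J v \<longleftrightarrow>
     (\<forall>\<omega> i. (\<Sum>j\<in>UNIV. J $ Inl i $ Inl j * v \<omega> $ j) =
        (\<Sum>j\<in>UNIV. \<Sum>k\<in>UNIV. c (Inl j) (Inl i) k * (\<Sum>l\<in>UNIV. J $ k $ Inl l * \<omega> $ l) * \<omega> $ j))"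

definition steady_motion :: "(real ^ 'p \<Rightarrow> real ^ 'p::finite) \<Rightarrow> real ^ 'p \<Rightarrow> bool" where
  "steady_motion v \<omega> \<longleftrightarrow> v \<omega> = 0"

definition SLSM :: "(real ^ 'p \<Rightarrow> real ^ 'p::finite) \<Rightarrow> (real ^ 'p) set \<Rightarrow> bool" where
  "SLSM v L \<longleftrightarrow> (\<exists>\<omega>\<^sub>0. \<omega>\<^sub>0 \<noteq> 0 \<and> steady_motion v \<omega>\<^sub>0 \<and> L = {\<mu> *\<^sub>R \<omega>\<^sub>0 | \<mu>. True})"

lemma reduced_EPS_field_ex1:
  fixes J :: "real ^ ('p::finite + 'm::finite) ^ ('p + 'm)"
  assumes "inertia_matrix J"
  shows "\<exists>!v. reduced_EPS_field c J v"
proof -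
  define A :: "real ^ 'p ^ 'p" where "A = (\<chi> i j. J $ Inl i $ Inl j)"
  define r :: "real ^ 'p \<Rightarrow> real ^ 'p" where "r = (\<lambda>\<omega>. \<chi> i.
    \<Sum>j\<in>UNIV. \<Sum>k\<in>UNIV. c (Inl j) (Inl i) k * (\<Sum>l\<in>UNIV. J $ k $ Inl l * \<omega> $ l) * \<omega> $ j)"
  have iff: "reduced_EPS_field c J v \<longleftrightarrow> (\<forall>\<omega>. A *v v \<omega> = r \<omega>)" for v
    by (simp add: reduced_EPS_field_def A_def r_def matrix_vector_mult_def vec_eq_iff)
  have "x = 0" if x: "A *v x = 0" for x
  proof (rule ccontr)
    assume "x \<noteq> 0"
    define y :: "real ^ ('p + 'm)" where "y = (\<chi> i. case i of Inl a \<Rightarrow> x $ a | Inr b \<Rightarrow> 0)"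
    have sum_split: "(\<Sum>i\<in>UNIV. f i) = (\<Sum>a\<in>UNIV. f (Inl a)) + (\<Sum>b\<in>UNIV. f (Inr b))"
      for f :: "'p + 'm \<Rightarrow> real"
      using sum.Plus[of UNIV UNIV f] by simp
    have "y \<bullet> (J *v y) = x \<bullet> (A *v x)"
      by (simp add: inner_vec_def matrix_vector_mult_def sum_split y_def A_def)
    moreover have "y \<noteq> 0"
    proof -
      obtain a where "x $ a \<noteq> 0"
        using \<open>x \<noteq> 0\<close> by (auto simp: vec_eq_iff)
      then have "y $ Inl a \<noteq> 0"
        by (simp add: y_def)
      then show ?thesis
        by auto
    qed
    ultimately show False
      using assms x by (auto simp: inertia_matrix_def)
  qed
  then have "invertible A"
    by (simp add: invertible_left_inverse matrix_left_invertible_ker)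
  then obtain B where B: "A ** B = mat 1" "B ** A = mat 1"
    by (auto simp: invertible_def)
  show ?thesis
  proof
    show "reduced_EPS_field c J (\<lambda>\<omega>. B *v r \<omega>)"
      by (simp add: iff matrix_vector_mul_assoc B)
  next
    fix v assume "reduced_EPS_field c J v"
    then have "B *v (A *v v \<omega>) = B *v r \<omega>" for \<omega>
      by (simp add: iff)
    then show "v = (\<lambda>\<omega>. B *v r \<omega>)"
      by (simp add: matrix_vector_mul_assoc B fun_eq_iff)
  qed
qed

end

theory Submission
  imports Defs
begin

text \<open>For \<open>p = 2\<close> with indices \<open>a\<close>, \<open>b\<close>, antisymmetry of the structure constants turns the right-hand
  sides of the two equations of motion into \<open>- L \<omega> * \<omega>\<^sub>b\<close> and \<open>L \<omega> * \<omega>\<^sub>a\<close>, where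
  \<open>L \<omega> = \<Sum>\<^sub>k c\<^sub>a\<^sub>b\<^sup>k m\<^sub>k(\<omega>)\<close> is a linear form. Hence the steady motions are exactly the zeros of \<open>L\<close>:
  the whole plane or a single line.\<close>

text \<open>The bracket is antisymmetric by its very formula. Linear independence of
  \<open>w\<close> over constants, tested on smooth functions, carries this over to the
  coefficients.\<close>

lemma structure_constants_antisym:
  assumes "left_invariant_basis charts gmult w" and "structure_constants charts w c"
  shows "c i j k = - c j i k"
proof -
  have "(\<Sum>k\<in>UNIV. (c i j k + c j i k) * w k f x) = 0" if "smooth_fun charts f" for f x
  proof -
    have "(\<Sum>k\<in>UNIV. (c i j k + c j i k) * w k f x)
        = lie_bracket (w i) (w j) f x + lie_bracket (w j) (w i) f x"
      using assms(2) that by (simp add: structure_constants_def distrib_right sum.distrib)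
    then show ?thesis
      by (simp add: lie_bracket_def)
  qed
  then have "c i j k + c j i k = 0"
    using assms(1) unfolding left_invariant_basis_def
    by (elim conjE) (drule spec[where x = "\<lambda>k. c i j k + c j i k"], blast)
  then show ?thesis
    by simp
qed

lemma steady_motion_iff_rhs_eq_0:
  fixes J :: "real ^ ('p::finite + 'm::finite) ^ ('p + 'm)"
  assumes "inertia_matrix J" and v: "reduced_EPS_field c J v"
  shows "steady_motion v \<omega> \<longleftrightarrow>
    (\<forall>i. (\<Sum>j\<in>UNIV. \<Sum>k\<in>UNIV.
      c (Inl j) (Inl i) k * (\<Sum>l\<in>UNIV. J $ k $ Inl l * \<omega> $ l) * \<omega> $ j) = 0)"
    (is "_ \<longleftrightarrow> ?R")
proof
  assume "steady_motion v \<omega>"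
  then have "(\<Sum>j\<in>UNIV. J $ Inl i $ Inl j * v \<omega> $ j) = 0" for i
    by (simp add: steady_motion_def)
  with v show ?R
    by (simp add: reduced_EPS_field_def)
next
  assume ?R
  \<comment> \<open>Redefining \<open>v\<close> as \<open>0\<close> at \<open>\<omega>\<close> gives another solution of the equations, so uniqueness applies.\<close>
  with v have "reduced_EPS_field c J (v(\<omega> := 0))"
    by (simp add: reduced_EPS_field_def)
  with v reduced_EPS_field_ex1[OF assms(1), of c] have "v = v(\<omega> := 0)"
    by blast
  then show "steady_motion v \<omega>"
    unfolding steady_motion_def by (metis fun_upd_same)
qed

lemma all_iff_if_UNIV_eq_doubleton:
  assumes "UNIV = {a, b}"
  shows "(\<forall>i. P i) \<longleftrightarrow> P a \<and> P b"
proof -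
  have "(\<forall>i. P i) \<longleftrightarrow> (\<forall>i\<in>UNIV. P i)"
    by simp
  also have "\<dots> \<longleftrightarrow> P a \<and> P b"
    unfolding assms by simp
  finally show ?thesis .
qed

text \<open>The kernel of a nonzero linear form on a plane is one-dimensional, so each of its
  nonzero vectors spans all of it.\<close>

lemma SLSM_ex1_if_steady_motion_iff:
  fixes v :: "real ^ 'p::finite \<Rightarrow> real ^ 'p"
  assumes UNIV: "(UNIV :: 'p set) = {a, b}" and "a \<noteq> b"
    and steady: "\<And>\<omega>. steady_motion v \<omega> \<longleftrightarrow> \<alpha> * \<omega> $ a + \<beta> * \<omega> $ b = 0"
    and nz: "\<alpha> \<noteq> 0 \<or> \<beta> \<noteq> 0"
  shows "\<exists>!L. SLSM v L"
proof -
  have vec_eq: "x = y \<longleftrightarrow> x $ a = y $ a \<and> x $ b = y $ b" for x y :: "real ^ 'p"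
    unfolding vec_eq_iff by (rule all_iff_if_UNIV_eq_doubleton[OF UNIV])
  define K where "K = {\<omega>. steady_motion v \<omega>}"
  \<comment> \<open>This serves twice: it makes \<open>K\<close> an SLSM once one nonzero steady
    motion is known, and it forces every SLSM to equal \<open>K\<close>.\<close>
  have line: "{\<mu> *\<^sub>R \<omega>\<^sub>0 |\<mu>. True} = K" if "\<omega>\<^sub>0 \<noteq> 0" "steady_motion v \<omega>\<^sub>0" for \<omega>\<^sub>0
  proof (intro set_eqI iffI)
    fix \<omega> assume "\<omega> \<in> {\<mu> *\<^sub>R \<omega>\<^sub>0 |\<mu>. True}"
    then obtain \<mu> where "\<omega> = \<mu> *\<^sub>R \<omega>\<^sub>0"
      by blast
    then have "\<alpha> * \<omega> $ a + \<beta> * \<omega> $ b = \<mu> * (\<alpha> * \<omega>\<^sub>0 $ a + \<beta> * \<omega>\<^sub>0 $ b)"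
      by (simp add: algebra_simps)
    with that show "\<omega> \<in> K"
      by (simp add: K_def steady)
  next
    fix \<omega> assume "\<omega> \<in> K"
    then have eq: "\<alpha> * \<omega> $ a + \<beta> * \<omega> $ b = 0" "\<alpha> * \<omega>\<^sub>0 $ a + \<beta> * \<omega>\<^sub>0 $ b = 0"
      using that by (simp_all add: K_def steady)
    \<comment> \<open>Eliminating one coefficient at a time from the two equations: the determinant
      of the two vectors is annihilated by both \<alpha> and \<beta>, one of which is
      nonzero.\<close>
    have "\<alpha> * (\<omega> $ a * \<omega>\<^sub>0 $ b - \<omega> $ b * \<omega>\<^sub>0 $ a) = 0"
      "\<beta> * (\<omega> $ a * \<omega>\<^sub>0 $ b - \<omega> $ b * \<omega>\<^sub>0 $ a) = 0"
      using eq by algebra+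
    with nz have det: "\<omega> $ a * \<omega>\<^sub>0 $ b = \<omega> $ b * \<omega>\<^sub>0 $ a"
      by auto
    have "\<omega>\<^sub>0 $ a \<noteq> 0 \<or> \<omega>\<^sub>0 $ b \<noteq> 0"
      using \<open>\<omega>\<^sub>0 \<noteq> 0\<close> by (simp add: vec_eq)
    then obtain \<mu> where "\<omega> $ a = \<mu> * \<omega>\<^sub>0 $ a" "\<omega> $ b = \<mu> * \<omega>\<^sub>0 $ b"
    proof
      assume "\<omega>\<^sub>0 $ a \<noteq> 0"
      then show ?thesis
        using det that[of "\<omega> $ a / \<omega>\<^sub>0 $ a"] by (simp add: field_simps)
    next
      assume "\<omega>\<^sub>0 $ b \<noteq> 0"
      then show ?thesis
        using det that[of "\<omega> $ b / \<omega>\<^sub>0 $ b"] by (simp add: field_simps)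
    qed
    then have "\<omega> = \<mu> *\<^sub>R \<omega>\<^sub>0"
      by (simp add: vec_eq)
    then show "\<omega> \<in> {\<mu> *\<^sub>R \<omega>\<^sub>0 |\<mu>. True}"
      by blast
  qed
  \<comment> \<open>The coefficient vector (\<alpha>, \<beta>) turned by a right angle: nonzero, and
    in the kernel of the form.\<close>
  define \<omega>\<^sub>1 :: "real ^ 'p" where "\<omega>\<^sub>1 = (\<chi> i. if i = a then - \<beta> else \<alpha>)"
  have "\<omega>\<^sub>1 $ a = - \<beta>" "\<omega>\<^sub>1 $ b = \<alpha>"
    using \<open>a \<noteq> b\<close> by (simp_all add: \<omega>\<^sub>1_def)
  with nz have "\<omega>\<^sub>1 \<noteq> 0" "steady_motion v \<omega>\<^sub>1"
    by (auto simp: steady)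
  with line have "SLSM v K"
    unfolding SLSM_def by blast
  moreover have "L = K" if "SLSM v L" for L
    using that line unfolding SLSM_def by blast
  ultimately show ?thesis
    by blast
qed

theorem theorem1:
  fixes gmult :: "'g::{t2_space, second_countable_topology} \<Rightarrow> 'g \<Rightarrow> 'g"
    and gunit :: 'g
    and ginv :: "'g \<Rightarrow> 'g"
    and charts :: "('g, 'p::finite + 'm::finite) atlas"
    and w :: "'p + 'm \<Rightarrow> ('g \<Rightarrow> real) \<Rightarrow> 'g \<Rightarrow> real"
    and c :: "'p + 'm \<Rightarrow> 'p + 'm \<Rightarrow> 'p + 'm \<Rightarrow> real"
    and J :: "real ^ ('p + 'm) ^ ('p + 'm)"
    and v :: "real ^ 'p \<Rightarrow> real ^ 'p"
  assumes "lie_group gmult gunit ginv charts"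
    and "left_invariant_basis charts gmult w"
    and "structure_constants charts w c"
    and "inertia_matrix J"
    and "reduced_EPS_field c J v"
    and "CARD('p) = 2"
  shows "(\<forall>\<omega>. steady_motion v \<omega>) \<or> (\<exists>!L. SLSM v L)"
proof -
  from \<open>CARD('p) = 2\<close> obtain a b :: 'p where ab: "UNIV = {a, b}" "a \<noteq> b"
    by (auto simp: card_2_iff)
  have sum_p: "(\<Sum>j\<in>UNIV. f j) = f a + f b" for f :: "'p \<Rightarrow> real"
    unfolding ab(1) using ab(2) by simp
  have all_p: "(\<forall>i. P i) \<longleftrightarrow> P a \<and> P b" for P :: "'p \<Rightarrow> bool"
    by (rule all_iff_if_UNIV_eq_doubleton[OF ab(1)])
  have antisym: "c i j k = - c j i k" for i j k
    using structure_constants_antisym assms(2,3) .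
  \<comment> \<open>With two indices this leaves a single value of \<open>j\<close> in each equation
    of motion.\<close>
  have diag: "c i i k = 0" for i k
    using antisym[of i i k] by simp
  \<comment> \<open>The coefficients of the linear form \<open>L\<close>. The sum over
    \<open>k\<close> includes the constrained directions, whose momenta need not vanish.\<close>
  define \<alpha> where "\<alpha> = (\<Sum>k\<in>UNIV. c (Inl a) (Inl b) k * J $ k $ Inl a)"
  define \<beta> where "\<beta> = (\<Sum>k\<in>UNIV. c (Inl a) (Inl b) k * J $ k $ Inl b)"
  have steady: "steady_motion v \<omega> \<longleftrightarrow> \<alpha> * \<omega> $ a + \<beta> * \<omega> $ b = 0" for \<omega>
  proof -
    define F where "F i = (\<Sum>j\<in>UNIV. \<Sum>k\<in>UNIV.
      c (Inl j) (Inl i) k * (\<Sum>l\<in>UNIV. J $ k $ Inl l * \<omega> $ l) * \<omega> $ j)" for i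
    define L where "L = \<alpha> * \<omega> $ a + \<beta> * \<omega> $ b"
    have L: "(\<Sum>k\<in>UNIV. c (Inl a) (Inl b) k * (J $ k $ Inl a * \<omega> $ a + J $ k $ Inl b * \<omega> $ b)) = L"
      by (simp add: L_def \<alpha>_def \<beta>_def sum_distrib_right sum.distrib distrib_left mult.assoc)
    have "F b = L * \<omega> $ a"
      by (simp add: F_def sum_p diag L[symmetric] sum_distrib_right)
    moreover have "F a = - L * \<omega> $ b"
      by (simp add: F_def sum_p diag antisym[of "Inl b" "Inl a"] sum_negf L[symmetric]
          sum_distrib_right)
    moreover have "steady_motion v \<omega> \<longleftrightarrow> F a = 0 \<and> F b = 0"
      using steady_motion_iff_rhs_eq_0[OF assms(4,5)] unfolding F_def all_p .
    \<comment> \<open>If both right-hand sides vanish, then \<open>L\<close> is zero or both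
      coordinates are; the second case also gives zero, by linearity.\<close>
    moreover have "L = 0" if "\<omega> $ a = 0" "\<omega> $ b = 0"
      using that by (simp add: L_def)
    ultimately show ?thesis
      unfolding L_def[symmetric] by auto
  qed
  show ?thesis
  proof (cases "\<alpha> = 0 \<and> \<beta> = 0")
    case True
    then show ?thesis
      by (simp add: steady)
  next
    case False
    then show ?thesis
      using SLSM_ex1_if_steady_motion_iff[OF ab steady] by blast
  qed
qed

end
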